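(* Let $C = P + \varepsilon Q$ be a reduced motion polynomial, and suppose that a rational curve of circularity $c$ and degree $d$ is a trajectory of the rational motion parameterised by $C$. Then $\deg C \ge d - c$. If $\deg C = d-c$, then the degree defect of the spherical motion component, i.e. $\deg \operatorname{mrpf} P$, equals $d-2c$.
   Context: $\mathbb{H}$ denotes the real quaternions with units $\mathbf{i},\mathbf{j},\mathbf{k}$, and $\mathbb{DH} = \mathbb{H} + \varepsilon\mathbb{H}$ the dual quaternions, where $\varepsilon^2=0$ and $\varepsilon$ commutes with everything. For $h = p + \varepsilon q$ with $p,q\in\mathbb{H}$, the conjugate is $\overline{h} = \overline{p} + \varepsilon \overline{q}$. In $\mathbb{DH}[t]$ and $\mathbb{H}[t]$ the indeterminate $t$ commutes with all coefficients, and conjugation of polynomials is done coefficientwise. A motion polynomial is a polynomial $C = P + \varepsilon Q \in \mathbb{DH}[t]$ with $P,Q\in\mathbb{H}[t]$ whose leading coefficient is invertible (i.e. has non-zero primal part) and such that $C\overline{C}$ has real coefficients, i.e. $P\overline{Q} + Q\overline{P} = 0$. It is called reduced if $P$ and $Q$ have no common real polynomial factor of positive degree. The maximal real polynomial factor $\operatorname{mrpf} P$ of $P$ is the real polynomial of maximal degree dividing $P$ (unique up to constant factor); its degree is called the spherical degree defect of $C$. Points of $\mathbb{P}^3$ are represented by non-zero $x = x_0 + x_1\mathbf{i}+x_2\mathbf{j}+x_3\mathbf{k}$ with $x_0,\dots,x_3\in\mathbb{R}$, up to real scalars. The trajectory of $x$ under $C$ is the rational curve $t \mapsto P x \overline{P}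 + 2x_0 P\overline{Q}$ in $\mathbb{P}^3$. A rational parametric equation $x = x_0 + x_1\mathbf{i}+x_2\mathbf{j}+x_3\mathbf{k}$ with $x_i\in\mathbb{R}[t]$ is reduced if $\gcd(x_0,x_1,x_2,x_3)$ has degree zero; dividing by the gcd gives a reduced equation of the same curve. The degree of the curve is the maximal degree of $x_0,\dots,x_3$ in a reduced equation, and its circularity is $\frac12\deg\gcd(x_0, x_1^2+x_2^2+x_3^2)$, computed with a reduced equation. *)

theory Defs
  imports Complex_Main
    "HOL-Computational_Algebra.Polynomial_Factorial" "HOL-Computational_Algebra.Field_as_Ring"
begin

section \<open>Quaternions\<close>

datatype quat = Quat (qRe: real) (qI: real) (qJ: real) (qK: real)

lemma quat_eq_iff:
  "x = y \<longleftrightarrow> qRe x = qRe y \<and> qI x = qI y \<and> qJ x = qJ y \<and> qK x = qK y"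
  by (cases x; cases y) auto

instantiation quat :: real_algebra_1
begin

definition "0 = Quat 0 0 0 0"
definition "1 = Quat 1 0 0 0"
definition "x + y = Quat (qRe x + qRe y) (qI x + qI y) (qJ x + qJ y) (qK x + qK y)"
definition "- x = Quat (- qRe x) (- qI x) (- qJ x) (- qK x)"
definition "x - y = Quat (qRe x - qRe y) (qI x - qI y) (qJ x - qJ y) (qK x - qK y)"
definition "r *\<^sub>R x = Quat (r * qRe x) (r * qI x) (r * qJ x) (r * qK x)"
definition
  "x * y = Quat
     (qRe x * qRe y - qI x * qI y - qJ x * qJ y - qK x * qK y)
     (qRe x * qI y + qI x * qRe y + qJ x * qK y - qK x * qJ y)
     (qRe x * qJ y - qI x * qK y + qJ x * qRe y + qK x * qI y)
     (qRe x * qK y + qI x * qJ y - qJ x * qI y + qK x * qRe y)"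

lemmas quat_defs = zero_quat_def one_quat_def plus_quat_def uminus_quat_def minus_quat_def
  scaleR_quat_def times_quat_def

instance
  by standard (auto simp: quat_defs algebra_simps)

end

lemma quat_units:
  defines "i \<equiv> Quat 0 1 0 0" and "j \<equiv> Quat 0 0 1 0" and "k \<equiv> Quat 0 0 0 1"
  shows "i * i = -1" "j * j = -1" "k * k = -1" "i * j * k = -1"
  by (simp_all add: i_def j_def k_def quat_defs)

lemma of_real_quat: "of_real r = Quat r 0 0 0"
  by (simp add: of_real_def quat_defs)

definition qcnj :: "quat \<Rightarrow> quat" where
  "qcnj x = Quat (qRe x) (- qI x) (- qJ x) (- qK x)"

section \<open>Dual quaternions\<close>

text \<open>\<open>DQuat p q\<close> stands for $p + \varepsilon q$.\<close>

datatype dquat = DQuat (primal: quat) (dual: quat)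

instantiation dquat :: real_algebra_1
begin

definition "0 = DQuat 0 0"
definition "1 = DQuat 1 0"
definition "x + y = DQuat (primal x + primal y) (dual x + dual y)"
definition "- x = DQuat (- primal x) (- dual x)"
definition "x - y = DQuat (primal x - primal y) (dual x - dual y)"
definition "r *\<^sub>R x = DQuat (r *\<^sub>R primal x) (r *\<^sub>R dual x)"
definition "x * y = DQuat (primal x * primal y) (primal x * dual y + dual x * primal y)"

lemmas dquat_defs = zero_dquat_def one_dquat_def plus_dquat_def uminus_dquat_def
  minus_dquat_def scaleR_dquat_def times_dquat_def

instance
  by standard (auto simp: dquat_defs algebra_simps)

end

definition dqcnj :: "dquat \<Rightarrow> dquat" where
  "dqcnj h = DQuat (qcnj (primal h)) (qcnj (dual h))"

section \<open>Polynomials with non-commutative coefficients\<close>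

text \<open>
  The library's product on \<open>'a poly\<close> needs commutative coefficients. This is the product of
  polynomials over an arbitrary ring whose indeterminate commutes with the coefficients.
\<close>

definition pmult :: "'a::ring_1 poly \<Rightarrow> 'a poly \<Rightarrow> 'a poly" (infixl "\<star>" 70) where
  "p \<star> q = (\<Sum>i\<le>degree p. \<Sum>j\<le>degree q. monom (coeff p i * coeff q j) (i + j))"

lemma coeff_pmult: "coeff (p \<star> q) n = (\<Sum>i\<le>n. coeff p i * coeff q (n - i))"
proof -
  have "coeff (p \<star> q) n
      = (\<Sum>i\<le>degree p. \<Sum>j\<le>degree q. if i + j = n then coeff p i * coeff q j else 0)"
    by (simp add: pmult_def coeff_sum)
  also have "\<dots> = (\<Sum>i\<le>degree p. if i \<le> n then coeff p i * coeff q (n - i) else 0)"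
  proof (rule sum.cong)
    fix i
    have "(\<Sum>j\<le>degree q. if i + j = n then coeff p i * coeff q j else 0)
        = (\<Sum>j\<le>degree q. if j = n - i then (if i \<le> n then coeff p i * coeff q j else 0) else 0)"
      by (rule sum.cong) auto
    also have "\<dots> = (if i \<le> n then coeff p i * coeff q (n - i) else 0)"
      by (auto simp: coeff_eq_0)
    finally show "(\<Sum>j\<le>degree q. if i + j = n then coeff p i * coeff q j else 0) = \<dots>" .
  qed simp
  also have "\<dots> = (\<Sum>i\<le>max n (degree p). if i \<le> n then coeff p i * coeff q (n - i) else 0)"
    by (rule sum.mono_neutral_left) (auto simp: coeff_eq_0)
  also have "\<dots> = (\<Sum>i\<le>n. coeff p i * coeff q (n - i))"
    by (rule sum.mono_neutral_cong_right) auto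
  finally show ?thesis .
qed

definition real_factor :: "real poly \<Rightarrow> quat poly \<Rightarrow> bool" where
  "real_factor r P \<longleftrightarrow> (\<exists>P'. P = map_poly of_real r \<star> P')"

text \<open>Only unique up to a constant factor, and only meaningful for \<open>P \<noteq> 0\<close>.\<close>

definition mrpf :: "quat poly \<Rightarrow> real poly" where
  "mrpf P = (ARG_MAX degree r. real_factor r P)"

section \<open>Motion polynomials\<close>

definition motion_polynomial :: "dquat poly \<Rightarrow> bool" where
  "motion_polynomial C \<longleftrightarrow>
     (\<exists>u. lead_coeff C * u = 1 \<and> u * lead_coeff C = 1) \<and>
     (\<forall>n. coeff (C \<star> map_poly dqcnj C) n \<in> \<real>)"

abbreviation primal_poly :: "dquat poly \<Rightarrow> quat poly" where
  "primal_poly C \<equiv> map_poly primal C"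

abbreviation dual_poly :: "dquat poly \<Rightarrow> quat poly" where
  "dual_poly C \<equiv> map_poly dual C"

lemma dquat_invertible_iff:
  fixes h :: dquat
  shows "(\<exists>u. h * u = 1 \<and> u * h = 1) \<longleftrightarrow> primal h \<noteq> 0"
proof
  assume "\<exists>u. h * u = 1 \<and> u * h = 1"
  then show "primal h \<noteq> 0"
    by (auto simp: times_dquat_def one_dquat_def)
next
  assume p: "primal h \<noteq> 0"
  let ?p = "primal h" and ?q = "dual h"
  define s where "s = (qRe ?p)\<^sup>2 + (qI ?p)\<^sup>2 + (qJ ?p)\<^sup>2 + (qK ?p)\<^sup>2"
  have "s \<noteq> 0"
    using p by (auto simp: s_def quat_eq_iff zero_quat_def add_nonneg_eq_0_iff)
  define v where "v = (1 / s) *\<^sub>R qcnj ?p"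
  have "?p * qcnj ?p = s *\<^sub>R 1" "qcnj ?p * ?p = s *\<^sub>R 1"
    by (simp_all add: s_def qcnj_def quat_defs power2_eq_square algebra_simps)
  with \<open>s \<noteq> 0\<close> have v: "?p * v = 1" "v * ?p = 1"
    by (simp_all add: v_def)
  let ?u = "DQuat v (- (v * ?q * v))"
  have "?p * (v * ?q * v) = ?q * v" "v * ?q * v * ?p = v * ?q"
    using v by (simp_all add: mult.assoc) (simp add: mult.assoc [symmetric])
  with v have "h * ?u = 1 \<and> ?u * h = 1"
    by (simp add: times_dquat_def one_dquat_def)
  then show "\<exists>u. h * u = 1 \<and> u * h = 1" ..
qed

lemma real_norm_polynomial_iff:
  fixes C :: "dquat poly"
  defines "P \<equiv> primal_poly C" and "Q \<equiv> dual_poly C"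
  shows "(\<forall>n. coeff (C \<star> map_poly dqcnj C) n \<in> \<real>) \<longleftrightarrow>
    P \<star> map_poly qcnj Q + Q \<star> map_poly qcnj P = 0"
proof -
  have c0: "primal 0 = 0" "dual 0 = 0" "qcnj 0 = 0" "dqcnj 0 = 0"
    by (simp_all add: zero_dquat_def dqcnj_def qcnj_def zero_quat_def)
  have dc: "coeff (map_poly dqcnj C) n = DQuat (qcnj (primal (coeff C n))) (qcnj (dual (coeff C n)))"
    for n
    by (subst coeff_map_poly) (simp_all add: c0, simp add: dqcnj_def)
  have sums: "primal (sum f A) = (\<Sum>i\<in>A. primal (f i))" "dual (sum f A) = (\<Sum>i\<in>A. dual (f i))"
    for f :: "nat \<Rightarrow> dquat" and A
    by (induction A rule: infinite_finite_induct) (simp_all add: c0 plus_dquat_def)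
  have ca: "qcnj (x + y) = qcnj x + qcnj y" for x y
    by (simp add: qcnj_def quat_defs)
  have qsums: "qcnj (sum f A) = (\<Sum>i\<in>A. qcnj (f i))" for f :: "nat \<Rightarrow> quat" and A
    by (induction A rule: infinite_finite_induct) (simp_all add: c0 ca)
  have cm: "qcnj (x * y) = qcnj y * qcnj x" "qcnj (qcnj x) = x" for x y
    by (simp_all add: qcnj_def quat_defs algebra_simps)
  have qreal: "qcnj x = x \<longleftrightarrow> x \<in> \<real>" for x
  proof
    assume "qcnj x = x"
    then have "x = of_real (qRe x)"
      by (auto simp: qcnj_def quat_eq_iff of_real_quat)
    then show "x \<in> \<real>"
      by (metis Reals_of_real)
  qed (auto simp: Reals_def of_real_quat qcnj_def)
  have dreal: "h \<in> \<real> \<longleftrightarrow> primal h \<in> \<real> \<and> dual h = 0" for h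
  proof
    assume "h \<in> \<real>"
    then show "primal h \<in> \<real> \<and> dual h = 0"
      by (auto simp: Reals_def of_real_def scaleR_dquat_def one_dquat_def)
  next
    assume "primal h \<in> \<real> \<and> dual h = 0"
    then obtain r where "h = of_real r"
      by (cases h) (auto simp: Reals_def of_real_def scaleR_dquat_def one_dquat_def)
    then show "h \<in> \<real>"
      by simp
  qed
  have prim: "primal (coeff (C \<star> map_poly dqcnj C) n) \<in> \<real>" for n
  proof -
    let ?p = "\<lambda>i. primal (coeff C i)"
    have "qcnj (\<Sum>i\<le>n. ?p i * qcnj (?p (n - i))) = (\<Sum>i\<le>n. ?p (n - i) * qcnj (?p i))"
      by (simp add: qsums cm)
    also have "\<dots> = (\<Sum>i\<le>n. ?p i * qcnj (?p (n - i)))"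
      by (rule sum.reindex_bij_witness [of _ "\<lambda>i. n - i" "\<lambda>i. n - i"]) auto
    finally show ?thesis
      by (simp add: qreal coeff_pmult sums dc coeff_map_poly c0 times_dquat_def)
  qed
  have "dual (coeff (C \<star> map_poly dqcnj C) n)
      = coeff (P \<star> map_poly qcnj Q + Q \<star> map_poly qcnj P) n" for n
    by (simp add: P_def Q_def coeff_pmult sums dc coeff_map_poly c0 times_dquat_def
        sum.distrib)
  with prim show ?thesis
    by (simp add: dreal poly_eq_iff)
qed

definition reduced_motion_polynomial :: "dquat poly \<Rightarrow> bool" where
  "reduced_motion_polynomial C \<longleftrightarrow>
     motion_polynomial C \<and>
     (\<nexists>r. degree r > 0 \<and> real_factor r (primal_poly C) \<and> real_factor r (dual_poly C))"

section \<open>Rational curves\<close>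

text \<open>
  A rational curve in projective 3-space is given by a parametric equation
  $x_0 + x_1 i + x_2 j + x_3 k \neq 0$ with real polynomials $x_0, \ldots, x_3$, that is,
  by a non-zero quaternion polynomial. Equations that differ by a non-zero real rational
  function represent the same curve.
\<close>

definition same_curve :: "quat poly \<Rightarrow> quat poly \<Rightarrow> bool" where
  "same_curve X Y \<longleftrightarrow>
     (\<exists>a b :: real poly. a \<noteq> 0 \<and> b \<noteq> 0 \<and> map_poly of_real a \<star> X = map_poly of_real b \<star> Y)"

definition curve_gcd :: "quat poly \<Rightarrow> real poly" where
  "curve_gcd X =
     gcd (gcd (map_poly qRe X) (map_poly qI X)) (gcd (map_poly qJ X) (map_poly qK X))"

text \<open>Degree and circularity are read off the reduced equation, i.e. after division by
  \<^term>\<open>curve_gcd X\<close>; both are invariant under \<^const>\<open>same_curve\<close>.\<close>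

definition curve_degree :: "quat poly \<Rightarrow> nat" where
  "curve_degree X =
     (let g = curve_gcd X
      in Max {degree (map_poly qRe X div g), degree (map_poly qI X div g),
              degree (map_poly qJ X div g), degree (map_poly qK X div g)})"

definition circularity :: "quat poly \<Rightarrow> real" where
  "circularity X =
     (let g = curve_gcd X
      in degree (gcd (map_poly qRe X div g)
           ((map_poly qI X div g)\<^sup>2 + (map_poly qJ X div g)\<^sup>2 + (map_poly qK X div g)\<^sup>2)) / 2)"

definition trajectory :: "dquat poly \<Rightarrow> quat \<Rightarrow> quat poly" where
  "trajectory C x =
     (let P = primal_poly C; Q = dual_poly C
      in P \<star> [:x:] \<star> map_poly qcnj P + [:of_real (2 * qRe x):] \<star> P \<star> map_poly qcnj Q)"

definition is_trajectory :: "quat poly \<Rightarrow> dquat poly \<Rightarrow> bool" where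
  "is_trajectory X C \<longleftrightarrow> (\<exists>x. x \<noteq> 0 \<and> same_curve X (trajectory C x))"

end

theory Submission
  imports Defs
begin

text \<open>
  The trajectory of \<open>x\<close> factors as \<open>Y = P R\<close> with \<open>R = x P* + 2 x\<^sub>0 Q*\<close>, where \<open>*\<close> is conjugation
  (\<open>trajectory_eq_pmult\<close>). Let \<open>N(A) = A A*\<close> be the norm polynomial, the sum of squares of the four
  real components; it is multiplicative, so \<open>N(Y) = N(P) N(R)\<close>. Since \<open>P Q* + Q P* = 0\<close>, the real
  part of \<open>Y\<close> is \<open>x\<^sub>0 N(P)\<close> (\<open>re_trajectory\<close>).
  Both \<open>P\<close> and \<open>R\<close> have the degree \<open>n\<close> of \<open>C\<close>, so \<open>Y\<close> has degree \<open>2n\<close>.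

  Degree and circularity are invariant under real rational multiples of the equation
  (\<open>same_curve_invariants\<close>), so they may be computed from \<open>Y\<close>.
  Let \<open>g\<close> be the gcd of the components of \<open>Y\<close>. Then \<open>d + deg g = 2n\<close>. In the gcd that defines the
  circularity, the sum of squares of the vector part may be replaced by the norm polynomial,
  because the two differ by the square of the real part; multiplying by \<open>g\<^sup>2\<close> yields
  \<open>2c + 2 deg g = deg gcd(g y\<^sub>0, N(Y))\<close> with \<open>y\<^sub>0\<close> the real part of \<open>Y\<close>
  (\<open>circularity_plus_degree_gcd\<close>). If \<open>x\<^sub>0 \<noteq> 0\<close>, the right-hand side is
  \<open>deg gcd(g N(P), N(P) N(R)) = 2n + deg gcd(g, N(R))\<close>, so that
  \<open>2(d - c) + deg gcd(g, N(R)) = 2n\<close>. This is the inequality, with equality exactly if \<open>g\<close> and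
  \<open>N(R)\<close> are coprime.

  In the case of equality, \<open>g\<close> divides \<open>Y R* = N(R) P\<close> and hence \<open>P\<close>; conversely each real factor of
  \<open>P\<close> divides \<open>Y\<close>. So \<open>g\<close> is the maximal real polynomial factor of \<open>P\<close>
  (\<open>degree_curve_gcd_eq_if_coprime\<close>), and \<open>deg g = 2n - d = d - 2c\<close>.

  If \<open>x\<^sub>0 = 0\<close>, then \<open>y\<^sub>0 = 0\<close> and \<open>c = d\<close>: the inequality is trivial, and equality means \<open>n = 0\<close>.
\<close>

section \<open>Quaternion polynomials as quadruples of real polynomials\<close>

abbreviation re_poly :: "quat poly \<Rightarrow> real poly" where "re_poly \<equiv> map_poly qRe"
abbreviation i_poly :: "quat poly \<Rightarrow> real poly" where "i_poly \<equiv> map_poly qI"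
abbreviation j_poly :: "quat poly \<Rightarrow> real poly" where "j_poly \<equiv> map_poly qJ"
abbreviation k_poly :: "quat poly \<Rightarrow> real poly" where "k_poly \<equiv> map_poly qK"
abbreviation cnj_poly :: "quat poly \<Rightarrow> quat poly" where "cnj_poly \<equiv> map_poly qcnj"
abbreviation real_mult :: "real poly \<Rightarrow> quat poly \<Rightarrow> quat poly" where
  "real_mult r P \<equiv> map_poly of_real r \<star> P"

lemma quat_zero_sel [simp]: "qRe 0 = 0" "qI 0 = 0" "qJ 0 = 0" "qK 0 = 0" "qcnj 0 = 0"
  by (simp_all add: zero_quat_def qcnj_def)

lemma quat_poly_eq_iff:
  "P = Q \<longleftrightarrow> re_poly P = re_poly Q \<and> i_poly P = i_poly Q \<and>
     j_poly P = j_poly Q \<and> k_poly P = k_poly Q"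
  by (auto simp: poly_eq_iff coeff_map_poly quat_eq_iff)

lemma quat_add_sel:
  "qRe (x + y) = qRe x + qRe y" "qI (x + y) = qI x + qI y"
  "qJ (x + y) = qJ x + qJ y" "qK (x + y) = qK x + qK y"
  by (simp_all add: plus_quat_def)

lemma quat_sum_sel:
  fixes f :: "'a \<Rightarrow> quat"
  shows "qRe (sum f A) = (\<Sum>i\<in>A. qRe (f i))" "qI (sum f A) = (\<Sum>i\<in>A. qI (f i))"
    "qJ (sum f A) = (\<Sum>i\<in>A. qJ (f i))" "qK (sum f A) = (\<Sum>i\<in>A. qK (f i))"
  by (induction A rule: infinite_finite_induct) (simp_all add: quat_add_sel)

lemma pmult_components:
  "re_poly (P \<star> Q) = re_poly P * re_poly Q - i_poly P * i_poly Q
     - j_poly P * j_poly Q - k_poly P * k_poly Q"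
  "i_poly (P \<star> Q) = re_poly P * i_poly Q + i_poly P * re_poly Q
     + j_poly P * k_poly Q - k_poly P * j_poly Q"
  "j_poly (P \<star> Q) = re_poly P * j_poly Q - i_poly P * k_poly Q
     + j_poly P * re_poly Q + k_poly P * i_poly Q"
  "k_poly (P \<star> Q) = re_poly P * k_poly Q + i_poly P * j_poly Q
     - j_poly P * i_poly Q + k_poly P * re_poly Q"
  by (rule poly_eqI, simp add: coeff_map_poly coeff_pmult coeff_mult quat_sum_sel
      times_quat_def sum.distrib sum_subtractf)+

lemma quat_poly_add_components:
  "re_poly (P + Q) = re_poly P + re_poly Q" "i_poly (P + Q) = i_poly P + i_poly Q"
  "j_poly (P + Q) = j_poly P + j_poly Q" "k_poly (P + Q) = k_poly P + k_poly Q"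
  by (rule poly_eqI, simp add: coeff_map_poly quat_add_sel)+

lemma cnj_poly_components:
  "re_poly (cnj_poly P) = re_poly P" "i_poly (cnj_poly P) = - i_poly P"
  "j_poly (cnj_poly P) = - j_poly P" "k_poly (cnj_poly P) = - k_poly P"
  by (rule poly_eqI, simp add: coeff_map_poly, simp add: qcnj_def)+

lemma of_real_poly_components:
  "re_poly (map_poly of_real r) = r" "i_poly (map_poly of_real r) = 0"
  "j_poly (map_poly of_real r) = 0" "k_poly (map_poly of_real r) = 0"
  by (rule poly_eqI, simp add: coeff_map_poly, simp add: of_real_quat)+

lemma const_quat_poly_components:
  "re_poly [:x:] = [:qRe x:]" "i_poly [:x:] = [:qI x:]"
  "j_poly [:x:] = [:qJ x:]" "k_poly [:x:] = [:qK x:]"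
  by (simp_all add: map_poly_pCons)

lemmas quat_poly_components = pmult_components quat_poly_add_components cnj_poly_components
  of_real_poly_components const_quat_poly_components

lemma real_mult_components:
  "re_poly (real_mult r P) = r * re_poly P" "i_poly (real_mult r P) = r * i_poly P"
  "j_poly (real_mult r P) = r * j_poly P" "k_poly (real_mult r P) = r * k_poly P"
  by (simp_all add: quat_poly_components)

text \<open>
  Divisibility statements about the components lift to real factors of the quaternion polynomial,
  because the componentwise quotients can be assembled into a quaternion polynomial.
\<close>

lemma ex_quat_poly:
  "\<exists>P. re_poly P = a \<and> i_poly P = b \<and> j_poly P = c \<and> k_poly P = d"
proof -
  define P where "P = map_poly (\<lambda>r. Quat r 0 0 0) a + map_poly (\<lambda>r. Quat 0 r 0 0) b
    + map_poly (\<lambda>r. Quat 0 0 r 0) c + map_poly (\<lambda>r. Quat 0 0 0 r) d"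
  have "coeff P n = Quat (coeff a n) (coeff b n) (coeff c n) (coeff d n)" for n
    by (simp add: P_def coeff_map_poly zero_quat_def plus_quat_def)
  then show ?thesis
    by (intro exI [of _ P]) (simp add: poly_eq_iff coeff_map_poly)
qed

lemma real_factor_iff_dvd:
  "real_factor r P \<longleftrightarrow> r dvd re_poly P \<and> r dvd i_poly P \<and> r dvd j_poly P \<and> r dvd k_poly P"
proof
  assume "real_factor r P"
  then show "r dvd re_poly P \<and> r dvd i_poly P \<and> r dvd j_poly P \<and> r dvd k_poly P"
    by (auto simp: real_factor_def real_mult_components)
next
  assume "r dvd re_poly P \<and> r dvd i_poly P \<and> r dvd j_poly P \<and> r dvd k_poly P"
  then obtain a b c d where
    "re_poly P = r * a" "i_poly P = r * b" "j_poly P = r * c" "k_poly P = r * d"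
    by (auto elim!: dvdE)
  moreover obtain P' where "re_poly P' = a" "i_poly P' = b" "j_poly P' = c" "k_poly P' = d"
    using ex_quat_poly by blast
  ultimately have "P = real_mult r P'"
    by (simp add: quat_poly_eq_iff [of P] real_mult_components)
  then show "real_factor r P"
    by (auto simp: real_factor_def)
qed

lemma real_factor_pmult:
  assumes "real_factor r P"
  shows "real_factor r (P \<star> Q)"
  using assms unfolding real_factor_iff_dvd pmult_components
  by (intro conjI dvd_add dvd_diff dvd_mult2) blast+

text \<open>
  The gcd of the components is therefore the greatest real factor, which links reduced
  equations of curves and the spherical degree defect.
\<close>

corollary real_factor_iff_dvd_curve_gcd: "real_factor r X \<longleftrightarrow> r dvd curve_gcd X"
  by (auto simp: real_factor_iff_dvd curve_gcd_def)


section \<open>The norm polynomial\<close>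

definition norm_poly :: "quat poly \<Rightarrow> real poly" where
  "norm_poly P = (re_poly P)\<^sup>2 + (i_poly P)\<^sup>2 + (j_poly P)\<^sup>2 + (k_poly P)\<^sup>2"

text \<open>
  This is Euler's four-square identity; it holds in every commutative ring, in particular for the
  component polynomials.
\<close>

lemma norm_poly_pmult: "norm_poly (P \<star> Q) = norm_poly P * norm_poly Q"
  unfolding norm_poly_def pmult_components by algebra

lemma norm_poly_real_mult: "norm_poly (real_mult r P) = r\<^sup>2 * norm_poly P"
  unfolding norm_poly_def real_mult_components by algebra

lemma pmult_cnj_cancel: "P \<star> R \<star> cnj_poly R = real_mult (norm_poly R) P"
  unfolding quat_poly_eq_iff [of "P \<star> R \<star> cnj_poly R"] quat_poly_components norm_poly_def
  by (intro conjI; algebra)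

text \<open>
  A sum of real squares vanishes only if all summands do, so the squares of the leading
  coefficients cannot cancel. The norm polynomial therefore carries degree computations for
  quaternion polynomials over to real polynomials.
\<close>

lemma degree_norm_poly: "degree (norm_poly P) = 2 * degree P"
proof (cases "P = 0")
  case True
  then show ?thesis by (simp add: norm_poly_def)
next
  case False
  let ?n = "degree P"
  have square: "degree (p\<^sup>2) \<le> 2 * ?n \<and> coeff (p\<^sup>2) (2 * ?n) = (coeff p ?n)\<^sup>2"
    if "degree p \<le> ?n" for p :: "real poly"
  proof (cases "degree p = ?n")
    case True
    then show ?thesis
      using coeff_mult_degree_sum [of p p] degree_mult_le [of p p]
      by (simp add: power2_eq_square mult_2)
  next
    case False
    with that have "degree p < ?n" by simp
    moreover from this have "degree (p\<^sup>2) < 2 * ?n"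
      using degree_mult_le [of p p] by (simp add: power2_eq_square)
    ultimately show ?thesis by (simp add: coeff_eq_0)
  qed
  note squares = square [OF map_poly_degree_leq, of qRe] square [OF map_poly_degree_leq, of qI]
    square [OF map_poly_degree_leq, of qJ] square [OF map_poly_degree_leq, of qK]
  have "coeff (norm_poly P) (2 * ?n) = (qRe (lead_coeff P))\<^sup>2 + (qI (lead_coeff P))\<^sup>2
      + (qJ (lead_coeff P))\<^sup>2 + (qK (lead_coeff P))\<^sup>2"
    using squares by (simp add: norm_poly_def coeff_map_poly)
  moreover have "lead_coeff P \<noteq> 0"
    using False by simp
  ultimately have "coeff (norm_poly P) (2 * ?n) \<noteq> 0"
    by (auto simp: quat_eq_iff add_nonneg_eq_0_iff)
  moreover have "degree (norm_poly P) \<le> 2 * ?n"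
    unfolding norm_poly_def using squares by (intro degree_add_le) auto
  ultimately show ?thesis
    by (metis le_antisym le_degree)
qed

lemma norm_poly_eq_0_iff [simp]: "norm_poly P = 0 \<longleftrightarrow> P = 0"
proof
  assume "norm_poly P = 0"
  moreover from this have "degree P = 0"
    using degree_norm_poly [of P] by simp
  then obtain x where "P = [:x:]" by (metis degree_eq_zeroE)
  ultimately show "P = 0"
    by (simp add: norm_poly_def const_quat_poly_components power2_eq_square)
      (auto simp: quat_eq_iff sum_squares_eq_zero_iff add_nonneg_eq_0_iff)
qed (simp add: norm_poly_def)

lemma degree_quat_pmult:
  fixes P Q :: "quat poly"
  shows "degree (P \<star> Q) = (if P = 0 \<or> Q = 0 then 0 else degree P + degree Q)"
proof -
  have "2 * degree (P \<star> Q) = degree (norm_poly P * norm_poly Q)"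
    by (simp add: degree_norm_poly norm_poly_pmult flip: degree_norm_poly)
  then show ?thesis
    by (auto simp: degree_mult_eq degree_norm_poly) (simp_all add: pmult_def)
qed


section \<open>Degree and circularity without reducing the equation\<close>

text \<open>
  Both invariants can be read off an arbitrary equation of the curve once the degree of the gcd is
  accounted for. In this form, they need no quotient, and their invariance under real
  multiples reduces to counting degrees.
\<close>

lemma degree_normalize_real_poly: "degree (normalize p) = degree (p :: real poly)"
proof (cases "p = 0")
  case False
  then show ?thesis
    by (intro antisym dvd_imp_degree_le) auto
qed simp

lemma degree_quat_poly_eq_Max:
  "degree P = Max {degree (re_poly P), degree (i_poly P), degree (j_poly P), degree (k_poly P)}"
    (is "_ = Max ?D")
proof (rule antisym)
  show "Max ?D \<le> degree P"
    by (simp add: map_poly_degree_leq)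
  show "degree P \<le> Max ?D"
  proof (cases "degree P = 0")
    case False
    then have "lead_coeff P \<noteq> 0" by auto
    then have "\<exists>f \<in> {qRe, qI, qJ, qK}. f (lead_coeff P) \<noteq> 0"
      by (auto simp: quat_eq_iff)
    then obtain f where f: "f \<in> {qRe, qI, qJ, qK}" "f (lead_coeff P) \<noteq> 0"
      by blast
    then have "degree P \<le> degree (map_poly f P)"
      by (intro le_degree) (auto simp: coeff_map_poly)
    also have "\<dots> \<le> Max ?D"
      using f(1) by (intro Max_ge) auto
    finally show ?thesis .
  qed simp
qed

lemma curve_gcd_eq_0_iff [simp]: "curve_gcd X = 0 \<longleftrightarrow> X = 0"
  by (simp add: curve_gcd_def quat_poly_eq_iff [of X])

lemma obtain_reduced_equation:
  assumes "X \<noteq> 0"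
  obtains X' where "X = real_mult (curve_gcd X) X'"
    "re_poly X div curve_gcd X = re_poly X'" "i_poly X div curve_gcd X = i_poly X'"
    "j_poly X div curve_gcd X = j_poly X'" "k_poly X div curve_gcd X = k_poly X'"
proof -
  have "real_factor (curve_gcd X) X"
    by (simp add: real_factor_iff_dvd_curve_gcd)
  then obtain X' where X': "X = real_mult (curve_gcd X) X'"
    unfolding real_factor_def by blast
  define g where "g = curve_gcd X"
  have "g \<noteq> 0"
    using assms by (simp add: g_def)
  moreover have "X = real_mult g X'"
    using X' unfolding g_def .
  ultimately show thesis
    using that [OF X'] unfolding g_def [symmetric] by (simp add: real_mult_components)
qed

lemma degree_real_mult:
  assumes "r \<noteq> 0" "P \<noteq> 0"
  shows "degree (real_mult r P) = degree r + degree P"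
proof -
  have "2 * degree (real_mult r P) = degree (r\<^sup>2 * norm_poly P)"
    by (simp add: norm_poly_real_mult flip: degree_norm_poly)
  then show ?thesis
    using assms by (simp add: degree_mult_eq degree_norm_poly degree_power_eq)
qed

lemma curve_degree_plus_degree_gcd:
  assumes "X \<noteq> 0"
  shows "curve_degree X + degree (curve_gcd X) = degree X"
proof -
  define g where "g = curve_gcd X"
  obtain X' where X': "X = real_mult g X'"
    "re_poly X div g = re_poly X'" "i_poly X div g = i_poly X'"
    "j_poly X div g = j_poly X'" "k_poly X div g = k_poly X'"
    using obtain_reduced_equation [OF assms] unfolding g_def by blast
  have g0: "g \<noteq> 0"
    using assms by (simp add: g_def)
  have X'0: "X' \<noteq> 0"
    using assms X'(1) by (auto simp: quat_poly_eq_iff real_mult_components)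
  have "curve_degree X = degree X'"
    by (simp add: curve_degree_def degree_quat_poly_eq_Max [of X'] X'(2-) Let_def
        flip: g_def)
  moreover have "degree X = degree g + degree X'"
    using degree_real_mult [OF g0 X'0] by (simp flip: X'(1))
  ultimately show ?thesis
    by (simp add: g_def)
qed

text \<open>
  The degrees are compared after multiplying the reduced equation by the gcd \<open>g\<close>: the norm
  polynomial scales with \<open>g\<^sup>2\<close> but the real part only with \<open>g\<close>, whence the additional factor \<open>g\<close> in
  the first argument.
\<close>

lemma circularity_plus_degree_gcd:
  assumes "X \<noteq> 0"
  shows "2 * circularity X + 2 * real (degree (curve_gcd X))
    = real (degree (gcd (curve_gcd X * re_poly X) (norm_poly X)))"
proof -
  define g where "g = curve_gcd X"
  obtain X' where X': "X = real_mult g X'"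
    "re_poly X div g = re_poly X'" "i_poly X div g = i_poly X'"
    "j_poly X div g = j_poly X'" "k_poly X div g = k_poly X'"
    using obtain_reduced_equation [OF assms] unfolding g_def by blast
  have g0: "g \<noteq> 0"
    using assms by (simp add: g_def)
  have X'0: "X' \<noteq> 0"
    using assms X'(1) by (auto simp: quat_poly_eq_iff real_mult_components)
  let ?h = "gcd (re_poly X') (norm_poly X')"
  \<comment> \<open>Adding the square of the real part to the vector part does not change the gcd.\<close>
  have "norm_poly X' = re_poly X' * re_poly X'
      + ((i_poly X')\<^sup>2 + (j_poly X')\<^sup>2 + (k_poly X')\<^sup>2)"
    by (simp add: norm_poly_def power2_eq_square)
  then have "?h = gcd (re_poly X') ((i_poly X')\<^sup>2 + (j_poly X')\<^sup>2 + (k_poly X')\<^sup>2)"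
    by (metis gcd_add_mult)
  then have c: "2 * circularity X = real (degree ?h)"
    by (simp add: circularity_def Let_def X'(2-) flip: g_def)
  have "?h \<noteq> 0"
    using X'0 by simp
  have "gcd (g * re_poly X) (norm_poly X) = gcd (g\<^sup>2 * re_poly X') (g\<^sup>2 * norm_poly X')"
    using real_mult_components(1) [of g X'] norm_poly_real_mult [of g X']
    by (simp add: power2_eq_square mult.assoc flip: X'(1))
  also have "\<dots> = normalize (g\<^sup>2 * ?h)"
    by (rule gcd_mult_left)
  finally have "degree (gcd (g * re_poly X) (norm_poly X)) = 2 * degree g + degree ?h"
    using g0 \<open>?h \<noteq> 0\<close>
    by (simp add: degree_normalize_real_poly degree_mult_eq degree_power_eq)
  with c show ?thesis
    by (simp add: g_def)
qed

lemma curve_gcd_real_mult: "curve_gcd (real_mult r X) = normalize (r * curve_gcd X)"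
  by (simp add: curve_gcd_def real_mult_components gcd_mult_left)

lemma curve_degree_real_mult:
  assumes "r \<noteq> 0" "X \<noteq> 0"
  shows "curve_degree (real_mult r X) = curve_degree X"
proof -
  have "real_mult r X \<noteq> 0"
    using assms by (auto simp: quat_poly_eq_iff real_mult_components)
  from curve_degree_plus_degree_gcd [OF this] curve_degree_plus_degree_gcd [OF assms(2)]
  show ?thesis
    using assms
    by (simp add: curve_gcd_real_mult degree_normalize_real_poly degree_mult_eq degree_real_mult)
qed

lemma circularity_real_mult:
  assumes "r \<noteq> 0" "X \<noteq> 0"
  shows "circularity (real_mult r X) = circularity X"
proof -
  let ?g = "curve_gcd X"
  have "real_mult r X \<noteq> 0"
    using assms by (auto simp: quat_poly_eq_iff real_mult_components)
  note c = circularity_plus_degree_gcd [OF this] circularity_plus_degree_gcd [OF assms(2)]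
  have "gcd (normalize (r * ?g) * (r * re_poly X)) (r\<^sup>2 * norm_poly X)
      = gcd (normalize (normalize (r * ?g) * (r * re_poly X))) (r\<^sup>2 * norm_poly X)"
    by (simp only: gcd.normalize_left_idem)
  also have "normalize (normalize (r * ?g) * (r * re_poly X))
      = normalize (r\<^sup>2 * (?g * re_poly X))"
    by (metis (no_types, opaque_lifting) normalize_mult_normalize_left mult.assoc mult.commute
        power2_eq_square)
  also have "gcd (normalize (r\<^sup>2 * (?g * re_poly X))) (r\<^sup>2 * norm_poly X)
      = normalize (r\<^sup>2 * gcd (?g * re_poly X) (norm_poly X))"
    by (simp add: gcd_mult_left)
  finally have "degree (gcd (curve_gcd (real_mult r X) * re_poly (real_mult r X))
        (norm_poly (real_mult r X)))
      = 2 * degree r + degree (gcd (?g * re_poly X) (norm_poly X))"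
    using assms by (simp add: curve_gcd_real_mult real_mult_components norm_poly_real_mult
        degree_normalize_real_poly degree_mult_eq degree_power_eq)
  moreover have "degree (curve_gcd (real_mult r X)) = degree r + degree ?g"
    using assms by (simp add: curve_gcd_real_mult degree_normalize_real_poly degree_mult_eq)
  ultimately show ?thesis
    using c by simp
qed

lemma same_curve_invariants:
  assumes "same_curve X Y" "X \<noteq> 0" "Y \<noteq> 0"
  shows "curve_degree X = curve_degree Y" "circularity X = circularity Y"
  using assms unfolding same_curve_def
  by (metis curve_degree_real_mult, metis circularity_real_mult)


section \<open>The spherical degree defect\<close>

text \<open>
  The arbitrary choice in \<^const>\<open>mrpf\<close> does not affect the degree, since all real factors divide the
  gcd of the components and that gcd is itself a real factor.
\<close>

lemma degree_mrpf:
  assumes "P \<noteq> 0"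
  shows "degree (mrpf P) = degree (curve_gcd P)"
proof -
  have bound: "degree r \<le> degree (curve_gcd P)" if "real_factor r P" for r
    using that assms by (intro dvd_imp_degree_le) (simp_all add: real_factor_iff_dvd_curve_gcd)
  have factor: "real_factor (curve_gcd P) P"
    by (simp add: real_factor_iff_dvd_curve_gcd)
  have "\<forall>r. real_factor r P \<longrightarrow> degree r < Suc (degree (curve_gcd P))"
    using bound by (simp add: le_imp_less_Suc)
  from arg_max_nat_lemma [of "\<lambda>r. real_factor r P", OF factor this] show ?thesis
    unfolding mrpf_def using bound factor by (intro antisym) blast+
qed

text \<open>
  The product of \<open>P R\<close> with the conjugate of \<open>R\<close> is the real multiple \<open>N(R) P\<close> of \<open>P\<close>. A real factor
  of \<open>P R\<close> that is coprime to \<open>N(R)\<close> must therefore already divide \<open>P\<close>.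
\<close>

lemma degree_curve_gcd_eq_if_coprime:
  assumes "P \<noteq> 0" "coprime (curve_gcd (P \<star> R)) (norm_poly R)"
  shows "degree (curve_gcd (P \<star> R)) = degree (mrpf P)"
proof -
  let ?g = "curve_gcd (P \<star> R)"
  have "real_factor ?g (P \<star> R)"
    by (simp add: real_factor_iff_dvd_curve_gcd)
  then have "real_factor ?g (P \<star> R \<star> cnj_poly R)"
    by (rule real_factor_pmult)
  with assms(2) have "real_factor ?g P"
    by (simp add: pmult_cnj_cancel real_factor_iff_dvd real_mult_components
        coprime_dvd_mult_right_iff)
  moreover have "real_factor (curve_gcd P) P"
    by (simp add: real_factor_iff_dvd_curve_gcd)
  then have "real_factor (curve_gcd P) (P \<star> R)"
    by (rule real_factor_pmult)
  ultimately have "?g dvd curve_gcd P" "curve_gcd P dvd ?g"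
    by (simp_all only: real_factor_iff_dvd_curve_gcd)
  then have "degree ?g = degree (curve_gcd P)"
    using assms(1) by (metis curve_gcd_eq_0_iff dvd_0_left_iff dvd_imp_degree_le le_antisym)
  with assms(1) show ?thesis
    by (simp add: degree_mrpf)
qed


section \<open>Trajectories of motion polynomials\<close>

definition trajectory_cofactor :: "dquat poly \<Rightarrow> quat \<Rightarrow> quat poly" where
  "trajectory_cofactor C x = [:x:] \<star> cnj_poly (primal_poly C)
     + [:of_real (2 * qRe x):] \<star> cnj_poly (dual_poly C)"

text \<open>
  The primal part can be taken out on the left because the scalar \<open>2 x\<^sub>0\<close> is real and hence central.
\<close>

lemma trajectory_eq_pmult: "trajectory C x = primal_poly C \<star> trajectory_cofactor C x"
  unfolding quat_poly_eq_iff [of "trajectory C x"]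
  unfolding trajectory_def trajectory_cofactor_def Let_def
    quat_poly_components of_real_quat quat.sel
  by (simp add: algebra_simps)

text \<open>
  The motion polynomial condition makes the real part of \<open>P Q*\<close> vanish, so the translational term
  does not contribute; and conjugating \<open>x\<close> with \<open>P\<close> scales its real part by the norm.
\<close>

lemma re_trajectory:
  assumes "motion_polynomial C"
  shows "re_poly (trajectory C x) = smult (qRe x) (norm_poly (primal_poly C))"
proof -
  define P Q where "P = primal_poly C" and "Q = dual_poly C"
  have "P \<star> cnj_poly Q + Q \<star> cnj_poly P = 0"
    using assms by (simp add: motion_polynomial_def real_norm_polynomial_iff P_def Q_def)
  then have "re_poly (P \<star> cnj_poly Q + Q \<star> cnj_poly P) = 0"
    by simp
  then have study: "re_poly P * re_poly Q + i_poly P * i_poly Q + j_poly P * j_poly Q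
      + k_poly P * k_poly Q = 0"
    by (simp add: quat_poly_components algebra_simps)
  have "re_poly (trajectory C x) = [:qRe x:] * norm_poly P + [:2 * qRe x:] *
      (re_poly P * re_poly Q + i_poly P * i_poly Q + j_poly P * j_poly Q + k_poly P * k_poly Q)"
    unfolding trajectory_def Let_def quat_poly_components of_real_quat quat.sel norm_poly_def
      power2_eq_square P_def Q_def
    by (simp add: algebra_simps smult_add_right)
  then show ?thesis
    unfolding study by (simp add: P_def)
qed

lemma degree_primal_poly:
  assumes "motion_polynomial C"
  shows "degree (primal_poly C) = degree C" "primal_poly C \<noteq> 0"
proof -
  have 0: "primal 0 = 0" by (simp add: zero_dquat_def)
  have "primal (lead_coeff C) \<noteq> 0"
    using assms by (simp add: motion_polynomial_def dquat_invertible_iff)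
  then have c: "coeff (primal_poly C) (degree C) \<noteq> 0"
    by (simp add: coeff_map_poly 0)
  then show "degree (primal_poly C) = degree C"
    by (intro antisym map_poly_degree_leq le_degree)
  show "primal_poly C \<noteq> 0"
    using c by auto
qed

lemma degree_trajectory_cofactor_le: "degree (trajectory_cofactor C x) \<le> degree C"
proof -
  have "degree ([:y:] \<star> cnj_poly (map_poly f C)) \<le> degree C" for y and f :: "dquat \<Rightarrow> quat"
    using map_poly_degree_leq [of qcnj "map_poly f C"] map_poly_degree_leq [of f C]
    by (simp add: degree_quat_pmult)
  then show ?thesis
    unfolding trajectory_cofactor_def by (intro degree_add_le)
qed

text \<open>
  The summands of the cofactor might cancel in top degree. If \<open>x\<^sub>0 = 0\<close>, only one summand is left.
  Otherwise the real part of the trajectory, a non-zero multiple of \<open>N(P)\<close>, already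
  has degree \<open>2n\<close>, which forces the cofactor to have degree at least \<open>n\<close>.
\<close>

lemma degree_trajectory_cofactor:
  assumes "motion_polynomial C" "x \<noteq> 0"
  shows "degree (trajectory_cofactor C x) = degree C \<and> trajectory_cofactor C x \<noteq> 0"
proof (cases "qRe x = 0")
  case True
  then have "trajectory_cofactor C x = [:x:] \<star> cnj_poly (primal_poly C)"
    by (simp add: trajectory_cofactor_def pmult_def)
  then have norm: "norm_poly (trajectory_cofactor C x) = norm_poly [:x:] * norm_poly (primal_poly C)"
    by (simp add: norm_poly_pmult) (simp add: norm_poly_def cnj_poly_components)
  then have "degree (norm_poly (trajectory_cofactor C x)) = 2 * degree C"
    using assms by (simp add: degree_mult_eq degree_norm_poly degree_primal_poly)
  with norm show ?thesis
    using assms degree_primal_poly(2) degree_norm_poly [of "trajectory_cofactor C x"]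
      norm_poly_eq_0_iff [of "trajectory_cofactor C x"]
    by auto
next
  case False
  then have "re_poly (trajectory C x) \<noteq> 0"
    using assms degree_primal_poly(2) by (simp add: re_trajectory)
  then have nz: "trajectory_cofactor C x \<noteq> 0"
    by (auto simp: trajectory_eq_pmult pmult_def)
  have "degree (norm_poly (primal_poly C)) = degree (re_poly (trajectory C x))"
    using assms(1) False by (simp add: re_trajectory)
  also have "\<dots> \<le> degree (trajectory C x)"
    by (rule map_poly_degree_leq)
  also have "\<dots> = degree C + degree (trajectory_cofactor C x)"
    using assms degree_primal_poly nz
    by (simp add: trajectory_eq_pmult degree_quat_pmult)
  finally show ?thesis
    using degree_trajectory_cofactor_le [of C x] assms(1) nz
    by (simp add: degree_norm_poly degree_primal_poly)
qed

theorem corollary1: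
  fixes C :: "dquat poly" and X :: "quat poly" and c :: real and d :: nat
  assumes "reduced_motion_polynomial C"
    and "X \<noteq> 0"
    and "circularity X = c"
    and "curve_degree X = d"
    and "is_trajectory X C"
  shows "real (degree C) \<ge> real d - c \<and>
    (real (degree C) = real d - c \<longrightarrow>
      real (degree (mrpf (primal_poly C))) = real d - 2 * c)"
proof -
  have C: "motion_polynomial C"
    using assms(1) by (simp add: reduced_motion_polynomial_def)
  obtain x where x: "x \<noteq> 0" "same_curve X (trajectory C x)"
    using assms(5) unfolding is_trajectory_def by blast
  define P R Y where "P = primal_poly C" and "R = trajectory_cofactor C x"
    and "Y = trajectory C x"
  define g where "g = curve_gcd Y"
  have Y: "Y = P \<star> R"
    by (simp add: Y_def P_def R_def trajectory_eq_pmult)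
  have P: "P \<noteq> 0" "degree P = degree C"
    using degree_primal_poly [OF C] by (simp_all add: P_def)
  have R: "R \<noteq> 0" "degree R = degree C"
    using degree_trajectory_cofactor [OF C x(1)] by (simp_all add: R_def)
  have normY: "norm_poly Y = norm_poly P * norm_poly R"
    by (simp add: Y norm_poly_pmult)
  then have "Y \<noteq> 0"
    using P(1) R(1) by (metis mult_eq_0_iff norm_poly_eq_0_iff)
  have "g \<noteq> 0"
    using \<open>Y \<noteq> 0\<close> by (simp add: g_def)
  have "degree Y = 2 * degree C"
    using P R by (simp add: Y degree_quat_pmult)
  with curve_degree_plus_degree_gcd [OF \<open>Y \<noteq> 0\<close>] have d: "d + degree g = 2 * degree C"
    using same_curve_invariants(1) [OF x(2) assms(2)] \<open>Y \<noteq> 0\<close> assms(4) by (simp add: Y_def g_def)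
  have c: "2 * c + 2 * real (degree g) = real (degree (gcd (g * re_poly Y) (norm_poly Y)))"
    using circularity_plus_degree_gcd [OF \<open>Y \<noteq> 0\<close>] same_curve_invariants(2) [OF x(2) assms(2)]
      \<open>Y \<noteq> 0\<close> assms(3) by (simp add: Y_def g_def)
  have reY: "re_poly Y = smult (qRe x) (norm_poly P)"
    using re_trajectory [OF C] by (simp add: Y_def P_def)
  show ?thesis
  proof (cases "qRe x = 0")
    \<comment> \<open>The real part of the trajectory is zero, so the gcd is the norm polynomial up to a
      constant factor.\<close>
    case True
    then have "degree (gcd (g * re_poly Y) (norm_poly Y)) = 4 * degree C"
      using P R by (simp add: reY normY degree_normalize_real_poly degree_mult_eq degree_norm_poly)
    with c d have "real d = c"
      by linarith
    moreover have "degree (mrpf P) \<le> degree P"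
      using map_poly_degree_leq [of qRe P] curve_degree_plus_degree_gcd [OF P(1)]
      by (simp add: degree_mrpf P(1))
    moreover have "d = 0" if "degree C = 0"
      using d that by linarith
    ultimately show ?thesis
      using P(2) unfolding P_def [symmetric] by linarith
  next
    case False
    let ?h = "gcd g (norm_poly R)"
    have "g * re_poly Y = norm_poly P * g * [:qRe x:]"
      by (simp add: reY mult.commute)
    moreover have "is_unit [:qRe x:]"
      using False by (simp add: is_unit_const_poly_iff dvd_field_iff)
    ultimately have "gcd (g * re_poly Y) (norm_poly Y)
        = gcd (norm_poly P * g) (norm_poly P * norm_poly R)"
      unfolding normY by (simp only: gcd_mult_unit1)
    also have "\<dots> = normalize (norm_poly P * ?h)"
      by (rule gcd_mult_left)
    finally have "2 * c + 2 * real (degree g) = 2 * real (degree C) + real (degree ?h)"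
      using c P \<open>g \<noteq> 0\<close>
      by (simp add: degree_normalize_real_poly degree_mult_eq degree_norm_poly)
    moreover have dr: "real d + real (degree g) = 2 * real (degree C)"
      using arg_cong [OF d, of real] by simp
    ultimately have "2 * (real d - c) + real (degree ?h) = 2 * real (degree C)"
      by algebra
    moreover have "degree (mrpf P) = degree g" if "degree ?h = 0"
    proof -
      have "is_unit ?h"
        using that \<open>g \<noteq> 0\<close> by (subst is_unit_iff_degree) simp_all
      then have "coprime (curve_gcd (P \<star> R)) (norm_poly R)"
        unfolding g_def Y is_unit_gcd .
      then show ?thesis
        unfolding g_def Y by (rule degree_curve_gcd_eq_if_coprime [OF P(1), symmetric])
    qed
    ultimately show ?thesis
      using dr unfolding P_def [symmetric] by auto
  qed
qed

end
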